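(* Let $b\in\mathbb{C}$ be non-zero and let $\mathbb{K}$ be the $\mathbb{C}$-algebra of hybrid numbers, with the weak Hopf algebra structure (depending on $b$) described in the context. Then the space $I^R(\mathbb{K})$ of right integrals in $\mathbb{K}$ is the $\mathbb{C}$-linear span $$I^{R}(\mathbb{K})=\mathbb{C}\left\langle \left(\tfrac1b-i\right)\mu+\nu+1,\ \ \frac{-1+2b(b+i)}{2b^2}\,\mu+\frac{ib-1}{b}\,\nu+g\right\rangle .$$
   Context: All vector spaces, linear maps and tensor products are over $\mathbb{C}$; $i$ is the imaginary unit. Hybrid numbers: $\mathbb{K}$ is the 4-dimensional associative unital $\mathbb{C}$-algebra with basis $1,g,\mu,\nu$ (unit $1$) and multiplication $g^2=-1$, $\mu^2=0$, $\nu^2=1$, $g\mu=1-\nu$, $\mu g=1+\nu$, $g\nu=\mu+g$, $\nu g=-\mu-g$, $\mu\nu=-\mu$, $\nu\mu=\mu$. Weak Hopf algebra structure on $\mathbb{K}$ (all maps linear): $\Delta(1)=\tfrac12\, 1\otimes 1-\tfrac12\,\mu\otimes\mu-\tfrac i2\,\nu\otimes\mu-\tfrac i2\,\mu\otimes\nu+\tfrac12\,\nu\otimes\nu$; $\Delta(g)=-\tfrac12\,\mu\otimes 1-\tfrac i2\,\nu\otimes 1+b\,g\otimes g+b\,\mu\otimes g+ib\,\nu\otimes g-\tfrac12\,1\otimes\mu+b\,g\otimes\mu+b\,\mu\otimes\mu+ib\,\nu\otimes\mu-\tfrac i2\,1\otimes\nu+ib\,g\otimes\nu+ib\,\mu\otimes\nu-b\,\nu\otimes\nu$;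 $\Delta(\mu)=\tfrac1{2b}\,\mu\otimes\mu$; $\Delta(\nu)=-\tfrac i2\,\mu\otimes 1+\tfrac12\,\nu\otimes 1-\tfrac i2\,1\otimes\mu+\tfrac i{2b}\,\mu\otimes\mu+\tfrac12\,1\otimes\nu$; $\varepsilon(1)=2$, $\varepsilon(g)=\tfrac1b$, $\varepsilon(\mu)=2b$, $\varepsilon(\nu)=2ib$; antipode $S(1)=1$, $S(g)=(-1+\tfrac1{2b^2})\mu-i\nu$, $S(\mu)=2b^2g+2b^2\mu+2ib^2\nu$, $S(\nu)=2ib^2g-(i-2ib^2)\mu+(1-2b^2)\nu$. With $\Delta(1)=1_{(1)}\otimes 1_{(2)}$ (Sweedler notation, summation omitted), $\varepsilon_s:\mathbb{K}\to\mathbb{K}$ is $\varepsilon_s(h)=\varepsilon(h1_{(2)})1_{(1)}$. A right integral in $\mathbb{K}$ is an element $r\in\mathbb{K}$ with $rx=r\varepsilon_s(x)$ for all $x\in\mathbb{K}$; $I^R(\mathbb{K})$ is the space of right integrals. *)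

theory Defs
  imports "HOL-Analysis.Analysis"
begin

section \<open>Tensor products of coordinate spaces\<close>

text \<open>
  A complex vector space with a chosen basis indexed by a finite type \<open>'n\<close> is \<open>complex ^ 'n\<close>,
  with scalar multiplication \<open>(*s)\<close> and span \<open>vec.span\<close>. The tensor product of \<open>complex ^ 'n\<close> and
  \<open>complex ^ 'm\<close> is \<open>complex ^ ('n \<times> 'm)\<close>; its basis vector with index \<open>(i, j)\<close> is the tensor
  product of the basis vectors with indices \<open>i\<close> and \<open>j\<close>. The library's componentwise \<open>(*)\<close> and
  \<open>1\<close> on \<open>complex ^ 'n\<close> play no role in the definitions: products and units of algebras are always explicit
  arguments.
\<close>

abbreviation bvec :: "'n::finite \<Rightarrow> complex ^ 'n" where
  "bvec k \<equiv> axis k 1"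

definition tens :: "complex ^ 'n \<Rightarrow> complex ^ 'm \<Rightarrow> complex ^ ('n \<times> 'm)"  (infixr "\<otimes>" 75) where
  "x \<otimes> y = (\<chi> p. x $ fst p * y $ snd p)"

definition lin_ext :: "('n::finite \<Rightarrow> complex ^ 'm) \<Rightarrow> complex ^ 'n \<Rightarrow> complex ^ 'm" where
  "lin_ext f x = (\<Sum>k\<in>UNIV. x $ k *s f k)"

text \<open>
  The linear map on the tensor product induced by a bilinear map \<open>B\<close>. It renders Sweedler
  notation: \<open>tens_lift B (\<Delta> h)\<close> is \<open>B h\<^sub>1 h\<^sub>2\<close> (summation omitted). \<open>tens_lift_form\<close> is the
  version for scalar-valued \<open>B\<close>.
\<close>

definition tens_lift ::
  "(complex ^ 'n \<Rightarrow> complex ^ 'm \<Rightarrow> complex ^ 'k) \<Rightarrow> complex ^ ('n::finite \<times> 'm::finite) \<Rightarrow> complex ^ 'k"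
where
  "tens_lift B t = (\<Sum>i\<in>UNIV. \<Sum>j\<in>UNIV. t $ (i, j) *s B (bvec i) (bvec j))"

definition tens_lift_form ::
  "(complex ^ 'n \<Rightarrow> complex ^ 'm \<Rightarrow> complex) \<Rightarrow> complex ^ ('n::finite \<times> 'm::finite) \<Rightarrow> complex"
where
  "tens_lift_form B t = (\<Sum>i\<in>UNIV. \<Sum>j\<in>UNIV. t $ (i, j) * B (bvec i) (bvec j))"


section \<open>Weak Hopf algebras and right integrals\<close>

definition eps_s ::
  "(complex ^ 'n \<Rightarrow> complex ^ 'n \<Rightarrow> complex ^ 'n) \<Rightarrow> complex ^ 'n \<Rightarrow>
   (complex ^ 'n \<Rightarrow> complex ^ ('n \<times> 'n)) \<Rightarrow> (complex ^ 'n \<Rightarrow> complex) \<Rightarrow>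
   complex ^ 'n \<Rightarrow> complex ^ ('n::finite)"
where
  "eps_s mul u \<Delta> \<epsilon> h = tens_lift (\<lambda>x y. \<epsilon> (mul h y) *s x) (\<Delta> u)"

definition eps_t ::
  "(complex ^ 'n \<Rightarrow> complex ^ 'n \<Rightarrow> complex ^ 'n) \<Rightarrow> complex ^ 'n \<Rightarrow>
   (complex ^ 'n \<Rightarrow> complex ^ ('n \<times> 'n)) \<Rightarrow> (complex ^ 'n \<Rightarrow> complex) \<Rightarrow>
   complex ^ 'n \<Rightarrow> complex ^ ('n::finite)"
where
  "eps_t mul u \<Delta> \<epsilon> h = tens_lift (\<lambda>x y. \<epsilon> (mul x h) *s y) (\<Delta> u)"

definition right_integral ::
  "(complex ^ 'n \<Rightarrow> complex ^ 'n \<Rightarrow> complex ^ 'n) \<Rightarrow> complex ^ 'n \<Rightarrow>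
   (complex ^ 'n \<Rightarrow> complex ^ ('n \<times> 'n)) \<Rightarrow> (complex ^ 'n \<Rightarrow> complex) \<Rightarrow>
   complex ^ ('n::finite) \<Rightarrow> bool"
where
  "right_integral mul u \<Delta> \<epsilon> r \<longleftrightarrow> (\<forall>x. mul r x = mul r (eps_s mul u \<Delta> \<epsilon> x))"

definition right_integrals ::
  "(complex ^ 'n \<Rightarrow> complex ^ 'n \<Rightarrow> complex ^ 'n) \<Rightarrow> complex ^ 'n \<Rightarrow>
   (complex ^ 'n \<Rightarrow> complex ^ ('n \<times> 'n)) \<Rightarrow> (complex ^ 'n \<Rightarrow> complex) \<Rightarrow>
   (complex ^ ('n::finite)) set"
where
  "right_integrals mul u \<Delta> \<epsilon> = {r. right_integral mul u \<Delta> \<epsilon> r}"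

text \<open>
  The axioms of Boehm, Nill and Szlachanyi. Tensors in the triple tensor product are compared in
  \<open>complex ^ ('n \<times> 'n \<times> 'n)\<close>, that is, bracketed to the right.
\<close>

locale weak_hopf_algebra =
  fixes mul :: "complex ^ 'n \<Rightarrow> complex ^ 'n \<Rightarrow> complex ^ ('n::finite)" (infixl "\<cdot>" 70)
    and u :: "complex ^ 'n"
    and \<Delta> :: "complex ^ 'n \<Rightarrow> complex ^ ('n \<times> 'n)"
    and \<epsilon> :: "complex ^ 'n \<Rightarrow> complex"
    and S :: "complex ^ 'n \<Rightarrow> complex ^ 'n"
  assumes mul_linear_left: "Vector_Spaces.linear (*s) (*s) (\<lambda>x. x \<cdot> y)"
    and mul_linear_right: "Vector_Spaces.linear (*s) (*s) (\<lambda>y. x \<cdot> y)"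
    and mul_assoc: "x \<cdot> y \<cdot> z = x \<cdot> (y \<cdot> z)"
    and unit_left: "u \<cdot> x = x"
    and unit_right: "x \<cdot> u = x"
    and comul_linear: "Vector_Spaces.linear (*s) (*s) \<Delta>"
    and counit_linear: "Vector_Spaces.linear (*s) (*) \<epsilon>"
    and antipode_linear: "Vector_Spaces.linear (*s) (*s) S"
    and coassoc: "tens_lift (\<lambda>x z. tens_lift (\<lambda>v w. v \<otimes> w \<otimes> z) (\<Delta> x)) (\<Delta> h)
      = tens_lift (\<lambda>x y. x \<otimes> \<Delta> y) (\<Delta> h)"
    and counit_left: "tens_lift (\<lambda>x y. \<epsilon> x *s y) (\<Delta> h) = h"
    and counit_right: "tens_lift (\<lambda>x y. \<epsilon> y *s x) (\<Delta> h) = h"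
    and comul_mul: "\<Delta> (x \<cdot> y)
      = tens_lift (\<lambda>v w. tens_lift (\<lambda>v' w'. (v \<cdot> v') \<otimes> (w \<cdot> w')) (\<Delta> y)) (\<Delta> x)"
    and weak_counit: "\<epsilon> (x \<cdot> y \<cdot> z) = tens_lift_form (\<lambda>v w. \<epsilon> (x \<cdot> v) * \<epsilon> (w \<cdot> z)) (\<Delta> y)"
    and weak_counit': "\<epsilon> (x \<cdot> y \<cdot> z) = tens_lift_form (\<lambda>v w. \<epsilon> (x \<cdot> w) * \<epsilon> (v \<cdot> z)) (\<Delta> y)"
    and weak_unit: "tens_lift (\<lambda>x y. x \<otimes> \<Delta> y) (\<Delta> u)
      = tens_lift (\<lambda>v w. tens_lift (\<lambda>v' w'. v \<otimes> (w \<cdot> v') \<otimes> w') (\<Delta> u)) (\<Delta> u)"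
    and weak_unit': "tens_lift (\<lambda>x y. x \<otimes> \<Delta> y) (\<Delta> u)
      = tens_lift (\<lambda>v w. tens_lift (\<lambda>v' w'. v \<otimes> (v' \<cdot> w) \<otimes> w') (\<Delta> u)) (\<Delta> u)"
    and antipode_right: "tens_lift (\<lambda>x y. x \<cdot> S y) (\<Delta> h) = eps_t mul u \<Delta> \<epsilon> h"
    and antipode_left: "tens_lift (\<lambda>x y. S x \<cdot> y) (\<Delta> h) = eps_s mul u \<Delta> \<epsilon> h"
    and antipode_both:
      "tens_lift (\<lambda>x y. tens_lift (\<lambda>v w. S x \<cdot> v \<cdot> S w) (\<Delta> y)) (\<Delta> h) = S h"


section \<open>Hybrid numbers\<close>

datatype hbasis = One | G | Mu | Nu

lemma UNIV_hbasis: "(UNIV :: hbasis set) = {One, G, Mu, Nu}"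
  using hbasis.exhaust by auto

instance hbasis :: finite
  by standard (simp add: UNIV_hbasis)

type_synonym hybrid = "complex ^ hbasis"
type_synonym hybrid2 = "complex ^ (hbasis \<times> hbasis)"

abbreviation h1 :: hybrid where "h1 \<equiv> bvec One"
abbreviation hg :: hybrid where "hg \<equiv> bvec G"
abbreviation h\<mu> :: hybrid where "h\<mu> \<equiv> bvec Mu"
abbreviation h\<nu> :: hybrid where "h\<nu> \<equiv> bvec Nu"

fun hmul_basis :: "hbasis \<Rightarrow> hbasis \<Rightarrow> hybrid" where
  "hmul_basis One y = bvec y"
| "hmul_basis x One = bvec x"
| "hmul_basis G G = - h1"
| "hmul_basis Mu Mu = 0"
| "hmul_basis Nu Nu = h1"
| "hmul_basis G Mu = h1 - h\<nu>"
| "hmul_basis Mu G = h1 + h\<nu>"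
| "hmul_basis G Nu = h\<mu> + hg"
| "hmul_basis Nu G = - h\<mu> - hg"
| "hmul_basis Mu Nu = - h\<mu>"
| "hmul_basis Nu Mu = h\<mu>"

definition hmul :: "hybrid \<Rightarrow> hybrid \<Rightarrow> hybrid" where
  "hmul x y = (\<Sum>i\<in>UNIV. \<Sum>j\<in>UNIV. (x $ i * y $ j) *s hmul_basis i j)"

fun hcomul_basis :: "complex \<Rightarrow> hbasis \<Rightarrow> hybrid2" where
  "hcomul_basis b One =
     (1/2) *s (h1 \<otimes> h1) - (1/2) *s (h\<mu> \<otimes> h\<mu>) - (\<i>/2) *s (h\<nu> \<otimes> h\<mu>) - (\<i>/2) *s (h\<mu> \<otimes> h\<nu>)
     + (1/2) *s (h\<nu> \<otimes> h\<nu>)"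
| "hcomul_basis b G =
     - (1/2) *s (h\<mu> \<otimes> h1) - (\<i>/2) *s (h\<nu> \<otimes> h1)
     + b *s (hg \<otimes> hg) + b *s (h\<mu> \<otimes> hg) + (\<i> * b) *s (h\<nu> \<otimes> hg)
     - (1/2) *s (h1 \<otimes> h\<mu>) + b *s (hg \<otimes> h\<mu>) + b *s (h\<mu> \<otimes> h\<mu>) + (\<i> * b) *s (h\<nu> \<otimes> h\<mu>)
     - (\<i>/2) *s (h1 \<otimes> h\<nu>) + (\<i> * b) *s (hg \<otimes> h\<nu>) + (\<i> * b) *s (h\<mu> \<otimes> h\<nu>) - b *s (h\<nu> \<otimes> h\<nu>)"
| "hcomul_basis b Mu = (1 / (2 * b)) *s (h\<mu> \<otimes> h\<mu>)"
| "hcomul_basis b Nu =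
     - (\<i>/2) *s (h\<mu> \<otimes> h1) + (1/2) *s (h\<nu> \<otimes> h1) - (\<i>/2) *s (h1 \<otimes> h\<mu>)
     + (\<i> / (2 * b)) *s (h\<mu> \<otimes> h\<mu>) + (1/2) *s (h1 \<otimes> h\<nu>)"

definition hcomul :: "complex \<Rightarrow> hybrid \<Rightarrow> hybrid2" where
  "hcomul b = lin_ext (hcomul_basis b)"

fun hcounit_basis :: "complex \<Rightarrow> hbasis \<Rightarrow> complex" where
  "hcounit_basis b One = 2"
| "hcounit_basis b G = 1 / b"
| "hcounit_basis b Mu = 2 * b"
| "hcounit_basis b Nu = 2 * \<i> * b"

definition hcounit :: "complex \<Rightarrow> hybrid \<Rightarrow> complex" where
  "hcounit b x = (\<Sum>k\<in>UNIV. x $ k * hcounit_basis b k)"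

fun hantipode_basis :: "complex \<Rightarrow> hbasis \<Rightarrow> hybrid" where
  "hantipode_basis b One = h1"
| "hantipode_basis b G = (- 1 + 1 / (2 * b^2)) *s h\<mu> - \<i> *s h\<nu>"
| "hantipode_basis b Mu = (2 * b^2) *s hg + (2 * b^2) *s h\<mu> + (2 * \<i> * b^2) *s h\<nu>"
| "hantipode_basis b Nu =
     (2 * \<i> * b^2) *s hg - (\<i> - 2 * \<i> * b^2) *s h\<mu> + (1 - 2 * b^2) *s h\<nu>"

definition hantipode :: "complex \<Rightarrow> hybrid \<Rightarrow> hybrid" where
  "hantipode b = lin_ext (hantipode_basis b)"


section \<open>The hybrid numbers form a weak Hopf algebra\<close>

lemma sum_hbasis: "(\<Sum>k\<in>UNIV. f k) = f One + f G + f Mu + f Nu"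
  by (simp add: UNIV_hbasis add.assoc)

lemma all_hbasis: "(\<forall>k. P k) \<longleftrightarrow> P One \<and> P G \<and> P Mu \<and> P Nu"
  by (metis hbasis.exhaust)

lemma vec_linear_iff: "Vector_Spaces.linear (*s) (*s) (f :: complex^'n \<Rightarrow> complex^'m) \<longleftrightarrow>
   (\<forall>x y. f (x + y) = f x + f y) \<and> (\<forall>c x. f (c *s x) = c *s f x)"
  by (auto simp: Vector_Spaces.linear_iff vec.vector_space_axioms)

lemma form_linear_iff: "Vector_Spaces.linear (*s) (*) (f :: complex^'n \<Rightarrow> complex) \<longleftrightarrow>
   (\<forall>x y. f (x + y) = f x + f y) \<and> (\<forall>c x. f (c *s x) = c * f x)"
  by (auto simp: Vector_Spaces.linear_iff vec.vector_space_axioms vector_space_over_itself.vector_space_axioms)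

lemma linear_hmul_left: "Vector_Spaces.linear (*s) (*s) (\<lambda>x. hmul x y)"
  and linear_hmul_right: "Vector_Spaces.linear (*s) (*s) (\<lambda>x. hmul y x)"
  by (simp_all add: vec_linear_iff hmul_def algebra_simps sum.distrib vec.scale_sum_right)

lemma linear_lin_ext: "Vector_Spaces.linear (*s) (*s) (lin_ext f)"
  by (simp add: vec_linear_iff lin_ext_def algebra_simps sum.distrib vec.scale_sum_right)

lemma lin_ext_bvec: "lin_ext f (bvec k) = f k"
proof -
  have "lin_ext f (bvec k) = (\<Sum>l\<in>UNIV. if l = k then f l else 0)"
    unfolding lin_ext_def by (intro sum.cong) (auto simp: axis_def)
  then show ?thesis by simp
qed

lemma linear_tens_lift: "Vector_Spaces.linear (*s) (*s) (tens_lift B)"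
  by (simp add: vec_linear_iff tens_lift_def algebra_simps sum.distrib vec.scale_sum_right)

lemma hcounit_linear: "Vector_Spaces.linear (*s) (*) (hcounit b)"
  by unfold_locales (simp_all add: hcounit_def algebra_simps sum.distrib sum_distrib_left)

lemma linear_simps:
  fixes f :: "complex^'n \<Rightarrow> complex^'m"
  assumes "Vector_Spaces.linear (*s) (*s) f"
  shows "f (x + y) = f x + f y" "f (c *s x) = c *s f x" "f (x - y) = f x - f y"
    "f (- x) = - f x" "f 0 = 0"
  using assms vec.linear_add vec.linear_scale vec.linear_diff vec.linear_neg vec.linear_0
  by blast+

lemma linear_form_simps:
  fixes f :: "complex^'n \<Rightarrow> complex"
  assumes "Vector_Spaces.linear (*s) (*) f"
  shows "f (x + y) = f x + f y" "f (c *s x) = c * f x" "f (x - y) = f x - f y"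
    "f (- x) = - f x" "f 0 = 0"
proof -
  interpret Vector_Spaces.linear "(*s)" "(*)" f by fact
  show "f (x + y) = f x + f y" "f (c *s x) = c * f x" "f (x - y) = f x - f y"
    "f (- x) = - f x" "f 0 = 0"
    by (simp_all add: add scale diff neg)
qed

lemma linear_tens_left: "Vector_Spaces.linear (*s) (*s) (\<lambda>x. x \<otimes> y)"
  and linear_tens_right: "Vector_Spaces.linear (*s) (*s) (\<lambda>y. x \<otimes> y)"
  by (simp_all add: vec_linear_iff tens_def vec_eq_iff algebra_simps)

lemma tens_lift_bvec: "tens_lift B (bvec i \<otimes> bvec j) = B (bvec i) (bvec j)"
proof -
  have "tens_lift B (bvec i \<otimes> bvec j) =
    (\<Sum>k\<in>UNIV. \<Sum>l\<in>UNIV. if l = j then if k = i then B (bvec k) (bvec l) else 0 else 0)"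
    unfolding tens_lift_def by (intro sum.cong) (auto simp: axis_def tens_def)
  then show ?thesis by simp
qed

lemma hmul_bvec: "hmul (bvec i) (bvec j) = hmul_basis i j"
proof -
  have "hmul (bvec i) (bvec j) =
    (\<Sum>k\<in>UNIV. \<Sum>l\<in>UNIV. if l = j then if k = i then hmul_basis k l else 0 else 0)"
    unfolding hmul_def by (intro sum.cong) (auto simp: axis_def)
  then show ?thesis by simp
qed

lemma hcomul_bvec: "hcomul b (bvec i) = hcomul_basis b i"
  and hantipode_bvec: "hantipode b (bvec i) = hantipode_basis b i"
  by (simp_all add: hcomul_def hantipode_def lin_ext_bvec)

lemma hcounit_bvec: "hcounit b (bvec i) = hcounit_basis b i"
  by (cases i) (simp_all add: hcounit_def sum_hbasis axis_def)

lemma linear_hcomul: "Vector_Spaces.linear (*s) (*s) (hcomul b)"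
  and linear_hantipode: "Vector_Spaces.linear (*s) (*s) (hantipode b)"
  by (simp_all add: hcomul_def hantipode_def linear_lin_ext)

lemma linear_tens_lift_form: "Vector_Spaces.linear (*s) (*) (tens_lift_form B)"
  by unfold_locales (simp_all add: tens_lift_form_def algebra_simps sum.distrib sum_distrib_left)

lemma tens_lift_form_bvec: "tens_lift_form B (bvec i \<otimes> bvec j) = B (bvec i) (bvec j)"
proof -
  have "tens_lift_form B (bvec i \<otimes> bvec j) =
    (\<Sum>k\<in>UNIV. \<Sum>l\<in>UNIV. if l = j then if k = i then B (bvec k) (bvec l) else 0 else 0)"
    unfolding tens_lift_form_def by (intro sum.cong) (auto simp: axis_def tens_def)
  then show ?thesis by simp
qed

lemmas lin_rules = linear_simps[OF linear_tens_left] linear_simps[OF linear_tens_right]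
  linear_simps[OF linear_hmul_left] linear_simps[OF linear_hmul_right]
  linear_simps[OF linear_hcomul] linear_simps[OF linear_hantipode]
  linear_simps[OF linear_tens_lift] linear_form_simps[OF linear_tens_lift_form]
  linear_form_simps[OF hcounit_linear]
  tens_lift_bvec tens_lift_form_bvec hmul_bvec hcomul_bvec hantipode_bvec hcounit_bvec

lemma hcounit_times_2: "hcounit b (x * 2) = 2 * hcounit b x" "hcounit b (2 * x) = 2 * hcounit b x"
  by (simp_all only: mult_2_right mult_2 lin_rules)

lemmas coord_rules = vec_eq_iff all_hbasis split_paired_All tens_def axis_def

lemma linear_eqI:
  fixes f g :: "hybrid \<Rightarrow> complex^'m"
  assumes "Vector_Spaces.linear (*s) (*s) f" "Vector_Spaces.linear (*s) (*s) g"
    and "\<And>k. f (bvec k) = g (bvec k)"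
  shows "f x = g x"
proof -
  have "x = (\<Sum>k\<in>UNIV. x $ k *s bvec k)" by (simp add: basis_expansion)
  then show ?thesis
    by (metis (no_types, lifting) assms vec.linear_sum vec.linear_scale sum.cong)
qed

lemma linear_form_eqI:
  fixes f g :: "hybrid \<Rightarrow> complex"
  assumes "Vector_Spaces.linear (*s) (*) f" "Vector_Spaces.linear (*s) (*) g"
    and "\<And>k. f (bvec k) = g (bvec k)"
  shows "f x = g x"
proof -
  have x: "x = x $ One *s h1 + x $ G *s hg + x $ Mu *s h\<mu> + x $ Nu *s h\<nu>" by (simp add: coord_rules)
  show ?thesis
    by (subst x, subst (2) x) (simp only: linear_form_simps[OF assms(1)] linear_form_simps[OF assms(2)] assms(3))
qed


lemma linear_tens_lift_param:
  assumes "\<And>v w. Vector_Spaces.linear (*s) (*s) (\<lambda>x. B x v w)"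
  shows "Vector_Spaces.linear (*s) (*s) (\<lambda>x. tens_lift (B x) t)"
  using assms
  by (simp add: vec_linear_iff tens_lift_def algebra_simps sum.distrib vec.scale_sum_right)

lemma linear_tens_lift_form_param:
  assumes "\<And>v w. Vector_Spaces.linear (*s) (*) (\<lambda>x. B x v w)"
  shows "Vector_Spaces.linear (*s) (*) (\<lambda>x. tens_lift_form (B x) t)"
  using assms
  by (simp add: form_linear_iff tens_lift_form_def algebra_simps sum.distrib sum_distrib_left)

lemma linear_eps_s: "Vector_Spaces.linear (*s) (*s) (eps_s hmul h1 (hcomul b) (hcounit b))"
  and linear_eps_t: "Vector_Spaces.linear (*s) (*s) (eps_t hmul h1 (hcomul b) (hcounit b))"
  unfolding eps_s_def[abs_def] eps_t_def[abs_def]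
  by (intro linear_tens_lift_param, simp add: vec_linear_iff lin_rules algebra_simps)+

theorem hybrid_weak_hopf_algebra:
  assumes b: "b \<noteq> 0"
  shows "weak_hopf_algebra hmul h1 (hcomul b) (hcounit b) (hantipode b)"
proof (rule weak_hopf_algebra.intro)
  fix h x y z :: hybrid
  let ?\<Delta> = "hcomul b" and ?\<epsilon> = "hcounit b" and ?S = "hantipode b"
  show "Vector_Spaces.linear (*s) (*s) (\<lambda>x. hmul x y)" "Vector_Spaces.linear (*s) (*s) (hmul x)"
    "Vector_Spaces.linear (*s) (*s) ?\<Delta>" "Vector_Spaces.linear (*s) (*) ?\<epsilon>"
    "Vector_Spaces.linear (*s) (*s) ?S"
    by (rule linear_hmul_left linear_hmul_right linear_hcomul hcounit_linear linear_hantipode)+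
  have "hmul (hmul (bvec i) (bvec j)) (bvec k) = hmul (bvec i) (hmul (bvec j) (bvec k))" for i j k
    by (cases i; cases j; cases k) (simp_all add: lin_rules)
  then have "hmul (hmul (bvec i) (bvec j)) z = hmul (bvec i) (hmul (bvec j) z)" for i j z
    by (rule linear_eqI[rotated 2]) (simp_all add: vec_linear_iff lin_rules)
  then have "hmul (hmul (bvec i) y) z = hmul (bvec i) (hmul y z)" for i y z
    by (rule linear_eqI[rotated 2]) (simp_all add: vec_linear_iff lin_rules)
  then show assoc: "hmul (hmul x y) z = hmul x (hmul y z)" for x y z
    by (rule linear_eqI[rotated 2]) (simp_all add: vec_linear_iff lin_rules)
  show "hmul h1 x = x"
    by (rule linear_eqI) (simp_all add: vec_linear_iff lin_rules)
  have "hmul (bvec k) h1 = bvec k" for k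
    by (cases k) (simp_all add: lin_rules)
  then show "hmul x h1 = x"
    by (rule linear_eqI[rotated 2]) (simp_all add: vec_linear_iff lin_rules)
  have "tens_lift (\<lambda>x z. tens_lift (\<lambda>v w. v \<otimes> w \<otimes> z) (?\<Delta> x)) (?\<Delta> (bvec k))
      = tens_lift (\<lambda>x y. x \<otimes> ?\<Delta> y) (?\<Delta> (bvec k))" for k
    by (cases k; simp add: lin_rules b; simp add: coord_rules; simp add: field_simps b)
  then show "tens_lift (\<lambda>x z. tens_lift (\<lambda>v w. v \<otimes> w \<otimes> z) (?\<Delta> x)) (?\<Delta> h)
      = tens_lift (\<lambda>x y. x \<otimes> ?\<Delta> y) (?\<Delta> h)"
    by (rule linear_eqI[rotated 2]) (simp_all add: vec_linear_iff lin_rules)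
  have "tens_lift (\<lambda>x y. ?\<epsilon> x *s y) (?\<Delta> (bvec k))
      = bvec k" for k
    by (cases k; simp add: lin_rules b; simp add: coord_rules; simp add: field_simps b)
  then show "tens_lift (\<lambda>x y. ?\<epsilon> x *s y) (?\<Delta> h) = h"
    by (rule linear_eqI[rotated 2]) (simp_all add: vec_linear_iff lin_rules)
  have "tens_lift (\<lambda>x y. ?\<epsilon> y *s x) (?\<Delta> (bvec k))
      = bvec k" for k
    by (cases k; simp add: lin_rules b; simp add: coord_rules; simp add: field_simps b)
  then show "tens_lift (\<lambda>x y. ?\<epsilon> y *s x) (?\<Delta> h) = h"
    by (rule linear_eqI[rotated 2]) (simp_all add: vec_linear_iff lin_rules)
  have "?\<Delta> (hmul (bvec k) (bvec l))
      = tens_lift (\<lambda>v w. tens_lift (\<lambda>v' w'. hmul v v' \<otimes> hmul w w') (?\<Delta> (bvec l))) (?\<Delta> (bvec k))"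
    for k l
    by (cases k; cases l; simp add: lin_rules b; simp add: coord_rules; simp add: field_simps b)
  then have "?\<Delta> (hmul (bvec k) y)
      = tens_lift (\<lambda>v w. tens_lift (\<lambda>v' w'. hmul v v' \<otimes> hmul w w') (?\<Delta> y)) (?\<Delta> (bvec k))"
    for k
    by (rule linear_eqI[rotated 2]; (intro linear_tens_lift_param)?)
       (simp_all add: vec_linear_iff lin_rules)
  then show "?\<Delta> (hmul x y)
      = tens_lift (\<lambda>v w. tens_lift (\<lambda>v' w'. hmul v v' \<otimes> hmul w w') (?\<Delta> y)) (?\<Delta> x)"
    by (rule linear_eqI[rotated 2]) (simp_all add: vec_linear_iff lin_rules)
  have "?\<epsilon> (hmul (hmul (bvec i) (bvec j)) (bvec k))
      = tens_lift_form (\<lambda>v w. ?\<epsilon> (hmul (bvec i) v) * ?\<epsilon> (hmul w (bvec k))) (?\<Delta> (bvec j))"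
    for i j k
    by (cases i; cases j; cases k; simp add: lin_rules hcounit_times_2 b;
        simp add: field_simps power2_eq_square b)
  then have "?\<epsilon> (hmul (hmul (bvec i) (bvec j)) z)
      = tens_lift_form (\<lambda>v w. ?\<epsilon> (hmul (bvec i) v) * ?\<epsilon> (hmul w z)) (?\<Delta> (bvec j))" for i j
    by (rule linear_form_eqI[rotated 2]; (intro linear_tens_lift_form_param)?)
       (simp_all add: form_linear_iff lin_rules algebra_simps)
  then have "?\<epsilon> (hmul (hmul x (bvec j)) z)
      = tens_lift_form (\<lambda>v w. ?\<epsilon> (hmul x v) * ?\<epsilon> (hmul w z)) (?\<Delta> (bvec j))" for j
    by (rule linear_form_eqI[rotated 2]; (intro linear_tens_lift_form_param)?)
       (simp_all add: form_linear_iff lin_rules algebra_simps)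
  then show "?\<epsilon> (hmul (hmul x y) z)
      = tens_lift_form (\<lambda>v w. ?\<epsilon> (hmul x v) * ?\<epsilon> (hmul w z)) (?\<Delta> y)"
    by (rule linear_form_eqI[rotated 2]) (simp_all add: form_linear_iff lin_rules)
  have "?\<epsilon> (hmul (hmul (bvec i) (bvec j)) (bvec k))
      = tens_lift_form (\<lambda>v w. ?\<epsilon> (hmul (bvec i) w) * ?\<epsilon> (hmul v (bvec k))) (?\<Delta> (bvec j))"
    for i j k
    by (cases i; cases j; cases k; simp add: lin_rules hcounit_times_2 b;
        simp add: field_simps power2_eq_square b)
  then have "?\<epsilon> (hmul (hmul (bvec i) (bvec j)) z)
      = tens_lift_form (\<lambda>v w. ?\<epsilon> (hmul (bvec i) w) * ?\<epsilon> (hmul v z)) (?\<Delta> (bvec j))" for i j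
    by (rule linear_form_eqI[rotated 2]; (intro linear_tens_lift_form_param)?)
       (simp_all add: form_linear_iff lin_rules algebra_simps)
  then have "?\<epsilon> (hmul (hmul x (bvec j)) z)
      = tens_lift_form (\<lambda>v w. ?\<epsilon> (hmul x w) * ?\<epsilon> (hmul v z)) (?\<Delta> (bvec j))" for j
    by (rule linear_form_eqI[rotated 2]; (intro linear_tens_lift_form_param)?)
       (simp_all add: form_linear_iff lin_rules algebra_simps)
  then show "?\<epsilon> (hmul (hmul x y) z)
      = tens_lift_form (\<lambda>v w. ?\<epsilon> (hmul x w) * ?\<epsilon> (hmul v z)) (?\<Delta> y)"
    by (rule linear_form_eqI[rotated 2]) (simp_all add: form_linear_iff lin_rules)
  show "tens_lift (\<lambda>x y. x \<otimes> ?\<Delta> y) (?\<Delta> h1)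
      = tens_lift (\<lambda>v w. tens_lift (\<lambda>v' w'. v \<otimes> hmul w v' \<otimes> w') (?\<Delta> h1)) (?\<Delta> h1)"
    by (simp add: lin_rules b; simp add: coord_rules; simp add: field_simps b)
  show "tens_lift (\<lambda>x y. x \<otimes> ?\<Delta> y) (?\<Delta> h1)
      = tens_lift (\<lambda>v w. tens_lift (\<lambda>v' w'. v \<otimes> hmul v' w \<otimes> w') (?\<Delta> h1)) (?\<Delta> h1)"
    by (simp add: lin_rules b; simp add: coord_rules; simp add: field_simps b)
  have "tens_lift (\<lambda>x y. hmul x (?S y)) (?\<Delta> (bvec k))
      = eps_t hmul h1 ?\<Delta> ?\<epsilon> (bvec k)" for k
    by (cases k; simp add: eps_s_def eps_t_def lin_rules b;
        simp add: coord_rules field_simps power2_eq_square power4_eq_xxxx b)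
  then show antipode_right: "tens_lift (\<lambda>x y. hmul x (?S y)) (?\<Delta> h)
      = eps_t hmul h1 ?\<Delta> ?\<epsilon> h" for h
    by (rule linear_eqI[rotated 2])
       (simp_all add: vec_linear_iff lin_rules linear_simps[OF linear_eps_s] linear_simps[OF linear_eps_t])
  have "tens_lift (\<lambda>x y. hmul (?S x) y) (?\<Delta> (bvec k))
      = eps_s hmul h1 ?\<Delta> ?\<epsilon> (bvec k)" for k
    by (cases k; simp add: eps_s_def eps_t_def lin_rules b;
        simp add: coord_rules field_simps power2_eq_square power4_eq_xxxx b)
  then show "tens_lift (\<lambda>x y. hmul (?S x) y) (?\<Delta> h)
      = eps_s hmul h1 ?\<Delta> ?\<epsilon> h"
    by (rule linear_eqI[rotated 2])
       (simp_all add: vec_linear_iff lin_rules linear_simps[OF linear_eps_s] linear_simps[OF linear_eps_t])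
  have "tens_lift (\<lambda>x y. hmul (?S x) (eps_t hmul h1 ?\<Delta> ?\<epsilon> y)) (?\<Delta> (bvec k))
      = ?S (bvec k)" for k
    by (cases k; simp add: eps_t_def lin_rules b;
        simp add: coord_rules field_simps power2_eq_square power4_eq_xxxx b)
  then have *: "tens_lift (\<lambda>x y. hmul (?S x) (eps_t hmul h1 ?\<Delta> ?\<epsilon> y)) (?\<Delta> h) = ?S h"
    by (rule linear_eqI[rotated 2]) (simp_all add: vec_linear_iff lin_rules)
  have "tens_lift (\<lambda>v w. hmul (hmul (?S x) v) (?S w)) (?\<Delta> y)
      = hmul (?S x) (eps_t hmul h1 ?\<Delta> ?\<epsilon> y)"
    for x y
    unfolding antipode_right[symmetric] assoc
    by (simp add: tens_lift_def linear_simps[OF linear_hmul_right] vec.linear_sum[OF linear_hmul_right])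
  with * show "tens_lift (\<lambda>x y. tens_lift (\<lambda>v w. hmul (hmul (?S x) v) (?S w)) (?\<Delta> y)) (?\<Delta> h)
      = ?S h"
    by simp
qed

end

theory Submission
  imports Defs
begin

text \<open>
  For \<open>q = 1/b - \<i>\<close>, the integral equation \<open>r \<mu> = r \<epsilon>\<^sub>s(\<mu>)\<close> alone determines the \<open>\<nu>\<close>- and
  \<open>\<mu>\<close>-coordinates of \<open>r\<close> from its \<open>1\<close>- and \<open>g\<close>-coordinates. The equation for \<open>\<nu>\<close> is a multiple of it,
  the equation for \<open>1\<close> is trivial, and the equation for \<open>g\<close> follows from
  \<open>q\<^sup>2 + 1 = (1/b) (1/b - 2 \<i>)\<close>.
\<close>

lemma eps_s_bvec:
  assumes "b \<noteq> 0"
  shows "eps_s hmul h1 (hcomul b) (hcounit b) h1 = h1"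
    and "eps_s hmul h1 (hcomul b) (hcounit b) hg
      = (1 / (2 * b)) *s h1 - (\<i> * (1 / b - 2 * \<i>) / 2) *s h\<mu> + ((1 / b - 2 * \<i>) / 2) *s h\<nu>"
    and "eps_s hmul h1 (hcomul b) (hcounit b) h\<mu> = b *s h1 + (\<i> * b) *s h\<mu> - b *s h\<nu>"
    and "eps_s hmul h1 (hcomul b) (hcounit b) h\<nu>
      = (\<i> * b) *s h1 - (\<i> + b) *s h\<mu> + (1 - \<i> * b) *s h\<nu>"
  using assms
  by (simp add: eps_s_def lin_rules; simp add: coord_rules; simp add: field_simps)+

text \<open>With these products and the values in \<open>eps_s_bvec\<close>, the integral equation
  at each basis vector becomes a linear system in the coordinates of \<open>r\<close>.\<close>

lemma hmul_coord:
  "hmul r h1 = r"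
  "hmul r hg = (r $ Mu - r $ G) *s h1 + (r $ One - r $ Nu) *s hg - r $ Nu *s h\<mu> + r $ Mu *s h\<nu>"
  "hmul r h\<mu> = r $ G *s h1 + (r $ One + r $ Nu) *s h\<mu> - r $ G *s h\<nu>"
  "hmul r h\<nu> = r $ Nu *s h1 + r $ G *s hg + (r $ G - r $ Mu) *s h\<mu> + r $ One *s h\<nu>"
  by (simp_all add: hmul_def sum_hbasis coord_rules)

text \<open>Only \<open>r $ One\<close> and \<open>r $ G\<close> stay free; the choices (1, 0) and
  (0, 1) give the two generators of the span.\<close>

lemma right_integral_iff:
  assumes b: "b \<noteq> 0" and q: "q = 1 / b - \<i>"
  shows "right_integral hmul h1 (hcomul b) (hcounit b) r \<longleftrightarrow>
    r $ Nu = r $ One - q * r $ G \<and> r $ Mu = q * r $ One + (1 - q\<^sup>2) / 2 * r $ G"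
    (is "?I \<longleftrightarrow> ?R")
proof
  let ?e = "eps_s hmul h1 (hcomul b) (hcounit b)"
  assume ?I
  then have "hmul r h\<mu> = hmul r (?e h\<mu>)"
    by (simp add: right_integral_def)
  then have "hmul r h\<mu> = b *s r + (\<i> * b) *s hmul r h\<mu> - b *s hmul r h\<nu>"
    by (simp only: eps_s_bvec[OF b] linear_simps[OF linear_hmul_right] hmul_coord(1))
  then have "hmul r h\<mu> $ k = b * r $ k + \<i> * b * hmul r h\<mu> $ k - b * hmul r h\<nu> $ k" for k
    by (metis vector_add_component vector_minus_component vector_smult_component)
  \<comment> \<open>The \<open>G\<close>-coordinate is trivial and the \<open>Nu\<close>-coordinate
    is the negative of the \<open>One\<close>-coordinate.\<close>
  from this[of One] this[of Mu]
  have "r $ G = b * r $ One + \<i> * b * r $ G - b * r $ Nu"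
    and "r $ One + r $ Nu = b * r $ Mu + \<i> * b * (r $ One + r $ Nu) - b * (r $ G - r $ Mu)"
    unfolding hmul_coord by (simp_all add: axis_def)
  \<comment> \<open>This form of \<open>q\<close> has no denominator, so what remains is polynomial;
    the factor \<open>b\<close> is cancelled afterwards.\<close>
  moreover have "b * q = 1 - \<i> * b"
    using b by (simp add: q field_simps)
  ultimately have "b * r $ Nu = b * (r $ One - q * r $ G)"
    and "b * (2 * r $ Mu) = b * (q * (r $ One + r $ Nu) + r $ G)"
    by algebra+
  with b have "r $ Nu = r $ One - q * r $ G" and "2 * r $ Mu = q * (r $ One + r $ Nu) + r $ G"
    by (simp_all only: mult_cancel_left) auto
  then have "r $ Nu = r $ One - q * r $ G" and "2 * r $ Mu = 2 * q * r $ One + (1 - q\<^sup>2) * r $ G"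
    by algebra+
  then show ?R
    by (simp add: field_simps)
next
  let ?e = "eps_s hmul h1 (hcomul b) (hcounit b)"
  \<comment> \<open>This reduces the square of \<i> inside right-nested products.\<close>
  have ii: "\<i> * (\<i> * z) = - z" for z :: complex
    by (simp flip: mult.assoc)
  assume R: ?R
  define a c where "a = r $ One" and "c = r $ G"
  have r: "r $ One = a" "r $ G = c" "r $ Nu = a - q * c" "r $ Mu = q * a + (1 - q\<^sup>2) / 2 * c"
    using R by (simp_all add: a_def c_def)
  have "hmul r (bvec k) = hmul r (?e (bvec k))" for k
    by (cases k; simp add: eps_s_bvec[OF b] lin_rules hmul_coord r;
        simp add: coord_rules r q; use b in \<open>simp add: field_simps power2_eq_square ii\<close>)
  then have "hmul r x = hmul r (?e x)" for x
    by (rule linear_eqI[rotated 2])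
       (simp_all add: vec_linear_iff lin_rules linear_simps[OF linear_eps_s])
  then show ?I
    by (simp add: right_integral_def)
qed

theorem theorem4p2:
  fixes b :: complex
  assumes "b \<noteq> 0"
  shows "right_integrals hmul h1 (hcomul b) (hcounit b)
    = vec.span {(1 / b - \<i>) *s h\<mu> + h\<nu> + h1,
                ((- 1 + 2 * b * (b + \<i>)) / (2 * b^2)) *s h\<mu> + ((\<i> * b - 1) / b) *s h\<nu> + hg}"
    (is "_ = vec.span {?v, ?w}")
proof -
  define q where "q = 1 / b - \<i>"
  have v: "?v = q *s h\<mu> + h\<nu> + h1"
    by (simp add: q_def)
  have "(- 1 + 2 * b * (b + \<i>)) / (2 * b^2) = (1 - q\<^sup>2) / 2" "(\<i> * b - 1) / b = - q"
    using assms by (simp_all add: q_def field_simps power2_eq_square)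
  then have w: "?w = ((1 - q\<^sup>2) / 2) *s h\<mu> + (- q) *s h\<nu> + hg"
    by simp
  have "r \<in> vec.span {?v, ?w} \<longleftrightarrow> (\<exists>s t. r = s *s ?v + t *s ?w)" for r
    by (auto simp: vec.span_insert vec.span_singleton algebra_simps)
  \<comment> \<open>\<open>h1\<close> occurs only in \<open>?v\<close> and \<open>hg\<close> only in
    \<open>?w\<close>, each with coefficient 1, which forces \<open>s = r $ One\<close> and
    \<open>t = r $ G\<close>.\<close>
  also have "\<dots> r \<longleftrightarrow> r $ Nu = r $ One - q * r $ G \<and>
      r $ Mu = q * r $ One + (1 - q\<^sup>2) / 2 * r $ G" for r
    unfolding v w by (auto simp: coord_rules algebra_simps)
  finally show ?thesis
    using right_integral_iff[OF assms q_def] by (auto simp: right_integrals_def)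
qed

end
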